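(* Let $g^{(0)}:V\to\mathbb{C}$ be a normalized signal (i.e. $\|g^{(0)}\|_2=1$) and let $f:V\to\mathbb{R}$ be a feature location. For $t\in\mathbb{R}$ let $g^{(t)}=\mathcal{S}[t,f]g^{(0)}$, where $\mathcal{S}[t,f]=e^{-it\Delta_f}$ and $\Delta_f=-\nabla_f^2$. Then, for every $t\in\mathbb{R}$, $$\mathcal{E}_{i\nabla_f}(g^{(t)})=\mathcal{E}_{i\nabla_f}(g^{(0)}).$$
   Context: $\mathcal{G}=(V,E)$ is a finite undirected weighted graph with $V=[N]=\{1,\dots,N\}$, $E\subset[N]^2$, and real symmetric adjacency matrix $A=(a_{n,m})\in\mathbb{R}^{N\times N}$ with $a_{n,m}=0$ whenever $n,m$ are not joined by an edge. Signals $g:V\to\mathbb{C}$ are identified with vectors in $\mathbb{C}^N$, with $\langle u,g\rangle=\sum_{v\in V}u(v)\overline{g(v)}$ and $\|g\|_2^2=\langle g,g\rangle$. A feature location is a function $f:V\to\mathbb{R}$. The $f$-partial derivative is the matrix $\nabla_f\in\mathbb{C}^{N\times N}$ with entries $(\nabla_f)_{n,m}=a_{n,m}(f(n)-f(m))$. For a self-adjoint operator $M$ on $\mathbb{C}^N$ and a normalized signal $g$, the expected value is $\mathcal{E}_M(g)=\langle Mg,g\rangle$. The matrix $i\nabla_f$ is self-adjoint. *)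

theory Defs
  imports "HOL-Analysis.Analysis"
begin

text \<open>
  Vertices are the elements of a finite type \<open>'n\<close>, with \<open>N = CARD('n)\<close>. Signals are vectors in
  \<open>complex ^ 'n\<close>, and operators on signals are matrices in \<open>complex ^ 'n ^ 'n\<close>.
\<close>

definition weighted_graph :: "('n \<times> 'n) set \<Rightarrow> real ^ 'n ^ 'n \<Rightarrow> bool" where
  "weighted_graph E A \<longleftrightarrow>
     sym E \<and> transpose A = A \<and> (\<forall>n m. (n, m) \<notin> E \<longrightarrow> A $ n $ m = 0)"

text \<open>
  The inner product is linear in the first and conjugate-linear in the second argument. The library
  norm of \<open>complex ^ 'n\<close> is the Euclidean norm that it induces; the library's \<open>inner\<close> is only its
  real part.
\<close>

definition cinner :: "complex ^ 'n \<Rightarrow> complex ^ 'n \<Rightarrow> complex" where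
  "cinner u g = (\<Sum>v\<in>UNIV. u $ v * cnj (g $ v))"

definition cscale_mat :: "complex \<Rightarrow> complex ^ 'n ^ 'n \<Rightarrow> complex ^ 'n ^ 'n" where
  "cscale_mat c M = map_matrix ((*) c) M"

primrec mat_power :: "complex ^ 'n ^ 'n \<Rightarrow> nat \<Rightarrow> complex ^ 'n ^ 'n" where
  "mat_power M 0 = mat 1"
| "mat_power M (Suc k) = M ** mat_power M k"

text \<open>
  The library's \<open>exp\<close> and \<open>(^)\<close> cannot be used for matrices: multiplication on the type
  \<open>complex ^ 'n ^ 'n\<close> is componentwise. The series converges for every matrix.
\<close>

definition mat_exp :: "complex ^ 'n ^ 'n \<Rightarrow> complex ^ 'n ^ 'n" where
  "mat_exp M = (\<Sum>k. (1 / fact k) *\<^sub>R mat_power M k)"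

definition partial_deriv :: "real ^ 'n ^ 'n \<Rightarrow> ('n \<Rightarrow> real) \<Rightarrow> complex ^ 'n ^ 'n" where
  "partial_deriv A f = (\<chi> n m. complex_of_real (A $ n $ m * (f n - f m)))"

definition laplacian :: "real ^ 'n ^ 'n \<Rightarrow> ('n \<Rightarrow> real) \<Rightarrow> complex ^ 'n ^ 'n" where
  "laplacian A f = - mat_power (partial_deriv A f) 2"

definition evolution :: "real ^ 'n ^ 'n \<Rightarrow> real \<Rightarrow> ('n \<Rightarrow> real) \<Rightarrow> complex ^ 'n ^ 'n" where
  "evolution A t f = mat_exp (cscale_mat (- \<i> * complex_of_real t) (laplacian A f))"

definition expected_value :: "complex ^ 'n ^ 'n \<Rightarrow> complex ^ 'n \<Rightarrow> complex" where
  "expected_value M g = cinner (M *v g) g"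

end

theory Submission
  imports Defs
begin

text \<open>
  Put \<open>X = - \<i> \<Delta>\<^sub>f\<close>, so that \<open>g t = exp (t X) g0\<close> satisfies \<open>g' = X g\<close>. The matrix \<open>\<nabla>\<^sub>f\<close> is
  real and antisymmetric, hence \<open>X = \<i> \<nabla>\<^sub>f\<^sup>2\<close> is skew-adjoint and commutes with \<open>B = \<i> \<nabla>\<^sub>f\<close>.
  Therefore \<open>\<langle>B g, g\<rangle>' = \<langle>B X g, g\<rangle> + \<langle>B g, X g\<rangle> = \<langle>X B g, g\<rangle> - \<langle>X B g, g\<rangle> = 0\<close>.
\<close>

lemma cscale_mat_nth [simp]: "cscale_mat c M $ i $ j = c * M $ i $ j"
  by (simp add: cscale_mat_def map_matrix_def)

lemma cscale_mat_mult_vec: "cscale_mat c M *v x = c *s (M *v x)"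
  by (simp add: vec_eq_iff matrix_vector_mult_def sum_distrib_left mult.assoc)

lemma cscale_mat_mult: "cscale_mat c M ** cscale_mat d L = cscale_mat (c * d) (M ** L)"
  by (simp add: vec_eq_iff matrix_matrix_mult_def sum_distrib_left mult_ac)

lemma mat_power_cscale_mat:
  "mat_power (cscale_mat c M) k = cscale_mat (c ^ k) (mat_power M k)"
proof (induction k)
  case 0
  show ?case by (simp add: vec_eq_iff)
next
  case (Suc k)
  then show ?case by (simp add: cscale_mat_mult)
qed

text \<open>Left multiplication by \<open>M\<close> is a linear map on a finite-dimensional space,
  hence bounded by some \<open>K\<close>; each further power of \<open>M\<close> then costs at most
  one factor \<open>K\<close>. This geometric growth makes the exponential series converge.\<close>

lemma norm_mat_power_le:
  fixes M :: "complex ^ 'n::finite ^ 'n"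
  obtains K where "K > 0" "\<And>k. norm (mat_power M k) \<le> norm (mat 1 :: complex ^ 'n ^ 'n) * K ^ k"
proof -
  have "linear (\<lambda>B :: complex ^ 'n ^ 'n. M ** B)"
    by (rule linearI)
      (simp_all add: vec_eq_iff matrix_matrix_mult_def algebra_simps sum.distrib scaleR_sum_right)
  then obtain K where K: "K > 0" "\<And>B :: complex ^ 'n ^ 'n. norm (M ** B) \<le> norm B * K"
    using bounded_linear.pos_bounded linear_conv_bounded_linear by blast
  have "norm (mat_power M k) \<le> norm (mat 1 :: complex ^ 'n ^ 'n) * K ^ k" for k
  proof (induction k)
    case (Suc k)
    have "norm (mat_power M (Suc k)) \<le> norm (mat_power M k) * K"
      using K(2) by simp
    also have "\<dots> \<le> norm (mat 1 :: complex ^ 'n ^ 'n) * K ^ k * K"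
      using Suc K(1) by (intro mult_right_mono) auto
    finally show ?case by (simp add: mult_ac)
  qed simp
  with K(1) show thesis by (rule that)
qed

lemma summable_mat_exp:
  fixes M :: "complex ^ 'n::finite ^ 'n"
  shows "summable (\<lambda>k. (1 / fact k) *\<^sub>R mat_power M k)"
proof -
  obtain K where K: "K > 0"
    "\<And>k. norm (mat_power M k) \<le> norm (mat 1 :: complex ^ 'n ^ 'n) * K ^ k"
    using norm_mat_power_le[of M] by blast
  have "summable (\<lambda>k. norm (mat 1 :: complex ^ 'n ^ 'n) * (inverse (fact k) * K ^ k))"
    by (intro summable_mult summable_exp)
  then show ?thesis
  proof (rule summable_comparison_test')
    fix k :: nat
    show "norm ((1 / fact k) *\<^sub>R mat_power M k)
        \<le> norm (mat 1 :: complex ^ 'n ^ 'n) * (inverse (fact k) * K ^ k)"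
      using K(2)[of k] by (simp add: field_simps)
  qed
qed

text \<open>Continuity in the matrix argument allows the series of \<open>mat_exp\<close> to be
  applied to \<open>x\<close> and read off one coordinate at a time.\<close>

lemma bounded_linear_mult_vec_nth:
  "bounded_linear (\<lambda>M :: complex ^ 'n::finite ^ 'n. (M *v x) $ i)"
proof -
  have "linear (\<lambda>M :: complex ^ 'n ^ 'n. (M *v x) $ i)"
    by (rule linearI)
      (simp_all add: matrix_vector_mult_def algebra_simps sum.distrib scaleR_sum_right)
  then show ?thesis
    by (simp add: linear_conv_bounded_linear)
qed

lemma mat_exp_mult_vec_nth_sums:
  fixes M :: "complex ^ 'n::finite ^ 'n"
  shows "(\<lambda>k. (mat_power M k *v x) $ i / fact k) sums (mat_exp M *v x) $ i"
proof -
  have "(\<lambda>k. (1 / fact k) *\<^sub>R mat_power M k) sums mat_exp M"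
    unfolding mat_exp_def by (rule summable_sums[OF summable_mat_exp])
  from bounded_linear.sums[OF bounded_linear_mult_vec_nth this, of x i]
  have "(\<lambda>k. (1 / fact k) *\<^sub>R (mat_power M k *v x) $ i) sums (mat_exp M *v x) $ i"
    by (simp add: linear_cmul[OF bounded_linear.linear[OF bounded_linear_mult_vec_nth]])
  moreover have "(1 / fact k) *\<^sub>R (mat_power M k *v x) $ i = (mat_power M k *v x) $ i / fact k" for k
    by (simp add: scaleR_conv_of_real)
  ultimately show ?thesis by simp
qed

text \<open>Each coordinate is a complex power series in the parameter that converges everywhere, so
  termwise differentiation of scalar series gives the differential equation of the flow.\<close>

lemma has_vector_derivative_mat_exp_mult_vec_nth:
  fixes M :: "complex ^ 'n::finite ^ 'n"
  shows "((\<lambda>t. (mat_exp (cscale_mat (of_real t) M) *v x) $ i) has_vector_derivative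
      (M *v (mat_exp (cscale_mat (of_real t) M) *v x)) $ i) (at t)"
proof -
  define c where "c j k = (mat_power M k *v x) $ j / fact k" for j k
  have sums: "(\<lambda>k. c j k * z ^ k) sums (mat_exp (cscale_mat z M) *v x) $ j" for j z
    using mat_exp_mult_vec_nth_sums[of "cscale_mat z M" x j]
    by (simp add: c_def mat_power_cscale_mat cscale_mat_mult_vec mult_ac)
  \<comment> \<open>The coefficient of the derivative is \<open>(k + 1) * c i (k + 1)\<close>. The
    factor \<open>k + 1\<close> turns \<open>fact (k + 1)\<close> into \<open>fact k\<close>, and
    the extra power of \<open>M\<close> splits off on the left.\<close>
  have diffs: "diffs (c i) k = (\<Sum>j\<in>UNIV. M $ i $ j * c j k)" for k
  proof -
    have "diffs (c i) k = (mat_power M (Suc k) *v x) $ i / fact k"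
      by (simp add: diffs_def c_def divide_simps del: of_nat_Suc)
    also have "mat_power M (Suc k) *v x = M *v (mat_power M k *v x)"
      by (simp add: matrix_vector_mul_assoc)
    also have "(M *v (mat_power M k *v x)) $ i / fact k = (\<Sum>j\<in>UNIV. M $ i $ j * c j k)"
      by (simp add: matrix_vector_mult_def[of M] c_def sum_divide_distrib)
    finally show ?thesis .
  qed
  have "(\<lambda>k. diffs (c i) k * z ^ k) sums (M *v (mat_exp (cscale_mat z M) *v x)) $ i" for z
    using sums_sum[of UNIV "\<lambda>j k. M $ i $ j * (c j k * z ^ k)", OF sums_mult[OF sums]]
    by (simp add: diffs sum_distrib_left mult_ac matrix_vector_mult_def[of M])
  then have eq: "(\<Sum>k. diffs (c i) k * z ^ k) = (M *v (mat_exp (cscale_mat z M) *v x)) $ i" for z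
    by (simp add: sums_iff)
  have "((\<lambda>z. \<Sum>k. c i k * z ^ k) has_field_derivative (\<Sum>k. diffs (c i) k * z ^ k)) (at z)" for z
    using sums by (intro termdiffs_strong_converges_everywhere) (simp add: sums_iff)
  then have "((\<lambda>z. (mat_exp (cscale_mat z M) *v x) $ i) has_field_derivative
      (M *v (mat_exp (cscale_mat z M) *v x)) $ i) (at z)" for z
    using sums by (simp add: sums_iff eq)
  \<comment> \<open>The complex derivative is restricted to the real axis.\<close>
  then show ?thesis
    by (rule has_vector_derivative_real_field)
qed

text \<open>Since \<open>0 ^ 0 = 1\<close>, exactly the term with \<open>k = 0\<close>
  survives.\<close>

lemma mat_exp_zero: "mat_exp (cscale_mat 0 M) = (mat 1 :: complex ^ 'n::finite ^ 'n)"
proof -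
  have "(1 / fact k) *\<^sub>R mat_power (cscale_mat 0 M) k
      = (if k = 0 then mat 1 else 0 :: complex ^ 'n ^ 'n)" for k
    by (simp add: mat_power_cscale_mat vec_eq_iff)
  then have "mat_exp (cscale_mat 0 M) = (\<Sum>k. if k = 0 then mat 1 else 0 :: complex ^ 'n ^ 'n)"
    by (simp add: mat_exp_def)
  also have "\<dots> = mat 1"
    using sums_single[of 0 "\<lambda>_. mat 1 :: complex ^ 'n ^ 'n"] by (simp add: sums_iff)
  finally show ?thesis .
qed

lemma cinner_scale_left: "cinner (c *s u) w = c * cinner u w"
  by (simp add: cinner_def sum_distrib_left mult_ac)

lemma cinner_scale_right: "cinner u (c *s w) = cnj c * cinner u w"
  by (simp add: cinner_def sum_distrib_left mult_ac)

text \<open>The hypothesis says that \<open>L\<close> is the adjoint of \<open>M\<close>; the claim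
  is an exchange of two finite sums.\<close>

lemma cinner_mult_vec_conjugate_transpose:
  fixes M L :: "complex ^ 'n::finite ^ 'n"
  assumes "\<And>n m. L $ n $ m = cnj (M $ m $ n)"
  shows "cinner (M *v u) w = cinner u (L *v w)"
proof -
  have "cinner (M *v u) w = (\<Sum>n\<in>UNIV. \<Sum>m\<in>UNIV. M $ n $ m * u $ m * cnj (w $ n))"
    by (simp add: cinner_def matrix_vector_mult_def sum_distrib_right)
  also have "\<dots> = (\<Sum>m\<in>UNIV. \<Sum>n\<in>UNIV. M $ n $ m * u $ m * cnj (w $ n))"
    by (rule sum.swap)
  also have "\<dots> = cinner u (L *v w)"
    by (simp add: cinner_def matrix_vector_mult_def sum_distrib_left assms mult_ac)
  finally show ?thesis .
qed

text \<open>The entries are real, and swapping the indices keeps the weight but flips the sign of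
  \<open>f n - f m\<close>; so the adjoint is the negative.\<close>

lemma cinner_partial_deriv:
  fixes A :: "real ^ 'n::finite ^ 'n"
  assumes "transpose A = A"
  shows "cinner (partial_deriv A f *v u) w = - cinner u (partial_deriv A f *v w)"
proof -
  have sym: "A $ n $ m = A $ m $ n" for n m
    by (subst assms[symmetric]) (simp add: transpose_def)
  have "(- partial_deriv A f) $ n $ m = cnj (partial_deriv A f $ m $ n)" for n m
    by (simp add: partial_deriv_def sym[of n m] algebra_simps)
  then have "cinner (partial_deriv A f *v u) w = cinner u ((- partial_deriv A f) *v w)"
    by (rule cinner_mult_vec_conjugate_transpose)
  also have "\<dots> = - cinner u (partial_deriv A f *v w)"
    by (simp add: cinner_def matrix_vector_mult_def sum_negf)
  finally show ?thesis .
qed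

text \<open>The conservation law in abstract form, with generator \<open>X\<close> and observable
  \<open>B\<close>; the graph enters only when the two assumptions are verified.\<close>

lemma expected_value_mat_exp:
  fixes B X :: "complex ^ 'n::finite ^ 'n"
  assumes skew: "\<And>u w. cinner (X *v u) w = - cinner u (X *v w)"
    and comm: "B ** X = X ** B"
  shows "expected_value B (mat_exp (cscale_mat (of_real t) X) *v x) = expected_value B x"
proof -
  define g where "g t = mat_exp (cscale_mat (of_real t) X) *v x" for t
  have g': "((\<lambda>t. g t $ i) has_vector_derivative (X *v g t) $ i) (at t)" for i t
    unfolding g_def by (rule has_vector_derivative_mat_exp_mult_vec_nth)
  have "((\<lambda>t. expected_value B (g t)) has_vector_derivative 0) (at t)" for t
  proof -
    have Bg': "((\<lambda>t. (B *v g t) $ i) has_vector_derivative (B *v (X *v g t)) $ i) (at t)" for i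
      by (simp add: matrix_vector_mult_def[of B])
        (intro has_vector_derivative_sum has_vector_derivative_mult_right g')
    \<comment> \<open>The product rule applies to the conjugated factor as well, because the
      parameter \<open>t\<close> is real and conjugation is real-linear.\<close>
    have "((\<lambda>t. expected_value B (g t)) has_vector_derivative
        (\<Sum>i\<in>UNIV. (B *v g t) $ i * cnj ((X *v g t) $ i) + (B *v (X *v g t)) $ i * cnj (g t $ i)))
        (at t)"
      unfolding expected_value_def cinner_def
      by (intro has_vector_derivative_sum has_vector_derivative_mult Bg'
          has_vector_derivative_cnj g')
    also have "(\<Sum>i\<in>UNIV. (B *v g t) $ i * cnj ((X *v g t) $ i)
          + (B *v (X *v g t)) $ i * cnj (g t $ i))
        = cinner (B *v g t) (X *v g t) + cinner (B *v (X *v g t)) (g t)"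
      by (simp add: cinner_def sum.distrib)
    also have "B *v (X *v g t) = X *v (B *v g t)"
      by (simp add: matrix_vector_mul_assoc comm)
    finally show ?thesis by (simp add: skew)
  qed
  \<comment> \<open>A vanishing derivative on the whole line forces a constant, which is then
    evaluated at time 0.\<close>
  then obtain c where "\<And>t. expected_value B (g t) = c"
    using has_vector_derivative_zero_constant[of UNIV "\<lambda>t. expected_value B (g t)"] by auto
  then have "expected_value B (g t) = expected_value B (g 0)"
    by simp
  then show ?thesis
    by (simp add: g_def mat_exp_zero)
qed

theorem theorem5:
  fixes E :: "('n::finite \<times> 'n) set" and A :: "real ^ 'n ^ 'n"
    and f :: "'n \<Rightarrow> real" and g0 :: "complex ^ 'n" and g :: "real \<Rightarrow> complex ^ 'n"
  assumes graph: "weighted_graph E A"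
    and normalized: "norm g0 = 1"
    and g_def: "\<And>t. g t = evolution A t f *v g0"
  shows "\<forall>t. expected_value (cscale_mat \<i> (partial_deriv A f)) (g t)
           = expected_value (cscale_mat \<i> (partial_deriv A f)) g0"
proof
  fix t
  define D where "D = partial_deriv A f"
  define X where "X = cscale_mat \<i> (D ** D)"
  \<comment> \<open>The minus sign in the exponent cancels the one in the Laplacian, which leaves
    the real parameter \<open>t\<close> times \<open>\<i>\<close> times the square of
    \<open>D\<close>.\<close>
  have evolution: "evolution A t f = mat_exp (cscale_mat (of_real t) X)"
  proof -
    have "cscale_mat (- \<i> * of_real t) (laplacian A f) = cscale_mat (of_real t) X"
      by (simp add: vec_eq_iff laplacian_def X_def D_def numeral_2_eq_2 mult_ac)
    then show ?thesis by (simp add: evolution_def)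
  qed
  have D: "cinner (D *v u) w = - cinner u (D *v w)" for u w
    using graph unfolding D_def weighted_graph_def by (intro cinner_partial_deriv) simp
  \<comment> \<open>Moving \<open>D\<close> across twice produces two signs that cancel; the
    remaining minus comes from conjugating \<open>\<i>\<close> in the second argument.\<close>
  have "cinner (X *v u) w = - cinner u (X *v w)" for u w
    by (simp add: X_def cscale_mat_mult_vec cinner_scale_left cinner_scale_right D
        flip: matrix_vector_mul_assoc)
  \<comment> \<open>Both products are the same scalar multiple of the cube of
    \<open>D\<close>.\<close>
  moreover have "cscale_mat \<i> D ** X = X ** cscale_mat \<i> D"
    by (simp add: X_def cscale_mat_mult matrix_mul_assoc)
  ultimately show "expected_value (cscale_mat \<i> (partial_deriv A f)) (g t)
      = expected_value (cscale_mat \<i> (partial_deriv A f)) g0"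
    unfolding g_def evolution D_def[symmetric] by (rule expected_value_mat_exp)
qed

end
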